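(* Let $G^{N}$ be a probe graph on $n$ vertices. Then $\operatorname{mr}(G^{N})=n-1$ if and only if $|N|\le 1$ and $G=P_n$, the path on $n$ vertices.
   Context: Graphs are finite, simple and undirected. For a graph $G$, $\mathcal S(G)$ is the set of real symmetric matrices indexed by $V(G)$ whose off-diagonal $ij$ entry is nonzero if and only if $ij\in E(G)$; diagonal entries are arbitrary. A probe graph $G^{N}$ is a graph $G$ with an independent set $N\subseteq V(G)$ of non-probe vertices. $\mathcal S(G^{N})$ is the union of $\mathcal S(H)$ over all graphs $H$ obtained from $G$ by adding any number of edges between vertices of $N$. $\operatorname{mr}(G^{N})$ is the minimum rank of a matrix in $\mathcal S(G^{N})$. *)

theory Defs
  imports "HOL-Analysis.Analysis"
begin

text \<open>
  A finite graph is given by its adjacency relation; the vertex set is the whole (finite, hence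
  nonempty) type \<open>'v\<close>, so the number of vertices is \<open>CARD('v)\<close>, and matrices indexed by
  the vertex set are elements of \<open>real^'v^'v\<close>.
\<close>

type_synonym 'v graph = "'v \<Rightarrow> 'v \<Rightarrow> bool"

definition simple_graph :: "'v graph \<Rightarrow> bool" where
  "simple_graph G \<longleftrightarrow> symp G \<and> irreflp G"

definition independent_in :: "'v graph \<Rightarrow> 'v set \<Rightarrow> bool" where
  "independent_in G N \<longleftrightarrow> (\<forall>u\<in>N. \<forall>v\<in>N. \<not> G u v)"

definition probe_graph :: "'v graph \<Rightarrow> 'v set \<Rightarrow> bool" where
  "probe_graph G N \<longleftrightarrow> simple_graph G \<and> independent_in G N"

definition probe_completions :: "'v graph \<Rightarrow> 'v set \<Rightarrow> 'v graph set" where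
  "probe_completions G N =
     {H. simple_graph H \<and> (\<forall>u v. G u v \<longrightarrow> H u v) \<and>
         (\<forall>u v. H u v \<and> \<not> G u v \<longrightarrow> u \<in> N \<and> v \<in> N)}"

definition sym_matrices :: "'v::finite graph \<Rightarrow> (real^'v^'v) set" where
  "sym_matrices G =
     {A. transpose A = A \<and> (\<forall>i j. i \<noteq> j \<longrightarrow> (A $ i $ j \<noteq> 0 \<longleftrightarrow> G i j))}"

definition probe_matrices :: "'v::finite graph \<Rightarrow> 'v set \<Rightarrow> (real^'v^'v) set" where
  "probe_matrices G N = (\<Union>H\<in>probe_completions G N. sym_matrices H)"

definition mr :: "'v::finite graph \<Rightarrow> 'v set \<Rightarrow> nat" where
  "mr G N = (LEAST r. \<exists>A\<in>probe_matrices G N. rank A = r)"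

definition path_graph :: "nat graph" where
  "path_graph i j \<longleftrightarrow> j = Suc i \<or> i = Suc j"

text \<open>
  \<open>G = P\<^sub>n\<close> is equality up to isomorphism; \<open>P\<^sub>n\<close> is the restriction of
  \<open>path_graph\<close> to \<open>{..<n}\<close>.
\<close>

definition is_path_graph :: "'v::finite graph \<Rightarrow> bool" where
  "is_path_graph G \<longleftrightarrow>
     (\<exists>f. bij_betw f {..<CARD('v)} UNIV \<and>
          (\<forall>i<CARD('v). \<forall>j<CARD('v). G (f i) (f j) \<longleftrightarrow> path_graph i j))"

text \<open>The minimum defining \<open>mr\<close> is over a nonempty set and hence attained.\<close>

lemma self_in_probe_completions:
  "probe_graph G N \<Longrightarrow> G \<in> probe_completions G N"
  by (simp add: probe_graph_def probe_completions_def)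

lemma sym_matrices_nonempty:
  fixes G :: "'v::finite graph"
  assumes "simple_graph G"
  shows "sym_matrices G \<noteq> {}"
proof -
  have "(\<chi> i j. of_bool (G i j)) \<in> sym_matrices G"
    using assms
    by (auto simp: sym_matrices_def simple_graph_def transpose_def vec_eq_iff of_bool_def symp_def)
  then show ?thesis by blast
qed

lemma mr_attained:
  fixes G :: "'v::finite graph"
  assumes "probe_graph G N"
  shows "\<exists>A\<in>probe_matrices G N. rank A = mr G N"
proof -
  obtain A where "A \<in> sym_matrices G"
    using assms sym_matrices_nonempty[of G] by (auto simp: probe_graph_def)
  then have "A \<in> probe_matrices G N"
    using self_in_probe_completions[OF assms] by (auto simp: probe_matrices_def)
  then have "\<exists>r. \<exists>A\<in>probe_matrices G N. rank A = r" by blast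
  then show ?thesis unfolding mr_def by (rule LeastI_ex)
qed

lemma mr_le: "A \<in> probe_matrices G N \<Longrightarrow> mr G N \<le> rank A"
  unfolding mr_def by (rule Least_le) blast

end

theory Submission
  imports Defs
begin

text \<open>
  The heart of the matter is Fiedler's theorem: if no matrix in \<open>sym_matrices G\<close> has corank
  at least two, then \<open>G\<close> is a path. It is proved by constructing, for every other graph, a
  matrix with two independent kernel vectors. All matrices used are Laplacians with
  possibly negative weights, plus a diagonal term, and the combinatorics of cycles and components is
  phrased through real-valued flows, so that connectedness and acyclicity become linear statements:
  two vertices are linked if a unit flow runs from one to the other, and \<open>G\<close> is a forest
  if it carries no nonzero circulation.

  Call an edge rigid if every circulation vanishes on it (these are the bridges). Suppose first that
  the rigid edges do not link all vertices. Some circulation \<open>s\<close> is nonzero on all edges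
  that are not rigid (\<open>generic_circulation\<close>), and the two ends of such an edge are not
  linked by rigid edges (\<open>not_linked_rigid_edges\<close>). Give each class of vertices linked by
  rigid edges its own potential \<open>t\<close>, and choose the weight of the edge \<open>ij\<close> by Ohm's law,
  \<open>s i j / (t j - t i)\<close>, or 1 if the edge is rigid. The current driven by \<open>t\<close> is then
  \<open>s\<close>, which obeys Kirchhoff's law, so both the constant vector and \<open>t\<close> are in the kernel
  of the Laplacian (\<open>low_rank_if_not_all_linked_rigidly\<close>).

  Otherwise \<open>G\<close> is a tree, because linked ends exclude edges that are not rigid.
  If some vertex \<open>c\<close> has three neighbours, then removing \<open>c\<close> leaves at least three branches,
  on each of which a suitable matrix is a singular Laplacian. Differences of the
  indicators of branches are kernel vectors, and three branches give two independent ones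
  (\<open>low_rank_if_branching_tree\<close>). A tree without such a vertex is a path
  (\<open>path_if_unbranched_tree\<close>).

  Conversely, a kernel vector of a matrix of a path is determined by its entry at an end
  (\<open>rank_ge_if_path\<close>), and the Laplacian is singular. For a probe graph, the minimum rank is
  \<open>n - 1\<close> only if all completions are paths; but two non-probe vertices allow adding an edge to
  \<open>G\<close>, and two paths on the same number of vertices have equally many edges
  (\<open>path_graph_maximal\<close>).
\<close>

section \<open>Rank and kernel\<close>

lemma dim_kernel_add_rank:
  fixes A :: "real^'n^'m"
  shows "dim {x. A *v x = 0} + rank A = CARD('n)"
proof -
  have "{y \<in> UNIV. \<forall>x\<in>span (rows A). orthogonal x y} = {x. A *v x = 0}"
  proof (intro set_eqI iffI)
    fix y assume "y \<in> {y \<in> UNIV. \<forall>x\<in>span (rows A). orthogonal x y}"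
    then have "orthogonal (row i A) y" for i
      by (auto intro: span_base simp: rows_def)
    then show "y \<in> {x. A *v x = 0}"
      by (simp add: vec_eq_iff matrix_vector_mul_component orthogonal_def row_def)
  qed (auto simp: orthogonal_commute dest: orthogonal_nullspace_rowspace)
  then show ?thesis
    using dim_subspace_orthogonal_to_vectors[of "span (rows A)" UNIV]
    by (simp add: row_rank_def)
qed

text \<open>
  A nonzero two by two minor witnesses that the kernel vectors are independent; in the applications
  the minor is read off directly from the vectors.
\<close>

lemma rank_le_if_two_kernel_vectors:
  fixes A :: "real^'n^'m"
  assumes "A *v x = 0" "A *v y = 0" and det: "x $ i * y $ j \<noteq> x $ j * y $ i"
  shows "rank A + 2 \<le> CARD('n)"
proof -
  have "x \<notin> span {y}"
  proof
    assume "x \<in> span {y}"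
    then obtain k where "x = k *\<^sub>R y" by (auto simp: span_singleton)
    with det show False by simp
  qed
  moreover have "y \<noteq> 0" using det by auto
  ultimately have "independent {x, y}" and "x \<noteq> y"
    by (auto simp: independent_insert span_base)
  then have "2 \<le> dim {x. A *v x = 0}"
    using independent_card_le_dim[of "{x, y}" "{x. A *v x = 0}"] assms by simp
  then show ?thesis using dim_kernel_add_rank[of A] by simp
qed

text \<open>
  Evaluation at coordinate \<open>i\<close> is injective on the kernel, which therefore has dimension at
  most one.
\<close>

lemma rank_ge_if_kernel_detected:
  fixes A :: "real^'n^'m"
  assumes "\<And>x. A *v x = 0 \<Longrightarrow> x $ i = 0 \<Longrightarrow> x = 0"
  shows "CARD('n) \<le> rank A + 1"
proof -
  have "dim {x. A *v x = 0} \<le> 1"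
  proof (cases "\<exists>y. A *v y = 0 \<and> y $ i \<noteq> 0")
    case True
    then obtain y where y: "A *v y = 0" "y $ i \<noteq> 0" by blast
    have "x \<in> span {y}" if "A *v x = 0" for x
    proof -
      have "x - (x $ i / y $ i) *\<^sub>R y = 0"
        using that y
        by (intro assms)
          (simp_all add: matrix_vector_mult_diff_distrib matrix_vector_mult_scaleR)
      then show ?thesis by (auto simp: span_singleton)
    qed
    then show ?thesis
      using dim_le_card[of "{x. A *v x = 0}" "{y}"] by auto
  next
    case False
    then have "{x. A *v x = 0} \<subseteq> {0}" using assms by blast
    then show ?thesis by (metis dim_eq_0 zero_le)
  qed
  then show ?thesis using dim_kernel_add_rank[of A] by simp
qed

text \<open>
  The discrete Schroedinger operator: the Laplacian of the edge weights \<open>w\<close>, with the sign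
  that makes \<open>w\<close> the off-diagonal part, plus the potential \<open>d\<close>. As the diagonal of a matrix
  in \<open>sym_matrices G\<close> is free, this parametrisation loses nothing.
\<close>

definition schroedinger_matrix :: "('v::finite \<Rightarrow> 'v \<Rightarrow> real) \<Rightarrow> ('v \<Rightarrow> real) \<Rightarrow> real^'v^'v" where
  "schroedinger_matrix w d = (\<chi> i j. if i = j then d i - (\<Sum>k\<in>UNIV - {i}. w i k) else w i j)"

lemma schroedinger_matrix_mult:
  "(schroedinger_matrix w d *v x) $ i = d i * x $ i + (\<Sum>j\<in>UNIV. w i j * (x $ j - x $ i))"
proof -
  have "(schroedinger_matrix w d *v x) $ i =
      (d i - (\<Sum>k\<in>UNIV - {i}. w i k)) * x $ i + (\<Sum>j\<in>UNIV - {i}. w i j * x $ j)"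
    by (simp add: matrix_vector_mult_def schroedinger_matrix_def sum.remove[of UNIV i])
  also have "\<dots> = d i * x $ i + (\<Sum>j\<in>UNIV - {i}. w i j * (x $ j - x $ i))"
    by (simp add: algebra_simps sum_subtractf sum_distrib_left)
  also have "\<dots> = d i * x $ i + (\<Sum>j\<in>UNIV. w i j * (x $ j - x $ i))"
    by (simp add: sum.remove[of UNIV i])
  finally show ?thesis .
qed

lemma schroedinger_matrix_in_sym_matrices:
  assumes "\<And>i j. w i j = w j i" "\<And>i j. i \<noteq> j \<Longrightarrow> w i j \<noteq> 0 \<longleftrightarrow> G i j"
  shows "schroedinger_matrix w d \<in> sym_matrices G"
  using assms
  by (auto simp: sym_matrices_def schroedinger_matrix_def transpose_def vec_eq_iff)

section \<open>Flows on a graph\<close>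

definition flow_on :: "'v graph \<Rightarrow> ('v \<Rightarrow> 'v \<Rightarrow> real) \<Rightarrow> bool" where
  "flow_on E f \<longleftrightarrow> (\<forall>i j. f i j + f j i = 0) \<and> (\<forall>i j. f i j \<noteq> 0 \<longrightarrow> E i j)"

definition outflow :: "('v::finite \<Rightarrow> 'v \<Rightarrow> real) \<Rightarrow> 'v \<Rightarrow> real" where
  "outflow f i = (\<Sum>j\<in>UNIV. f i j)"

definition circulation :: "'v::finite graph \<Rightarrow> ('v \<Rightarrow> 'v \<Rightarrow> real) \<Rightarrow> bool" where
  "circulation E f \<longleftrightarrow> flow_on E f \<and> (\<forall>i. outflow f i = 0)"

text \<open>
  The two terms cancel if \<open>u = v\<close>, so the unit flow along a loop is zero.
\<close>

definition edge_flow :: "'v \<Rightarrow> 'v \<Rightarrow> 'v \<Rightarrow> 'v \<Rightarrow> real" where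
  "edge_flow u v i j = of_bool (i = u \<and> j = v) - of_bool (i = v \<and> j = u)"

text \<open>
  For a symmetric \<open>E\<close> this is being in the same connected component; the flow replaces a chosen
  walk from \<open>u\<close> to \<open>v\<close>.
\<close>

definition linked :: "'v::finite graph \<Rightarrow> 'v \<Rightarrow> 'v \<Rightarrow> bool" where
  "linked E u v \<longleftrightarrow> (\<exists>f. flow_on E f \<and> (\<forall>i. outflow f i = of_bool (i = u) - of_bool (i = v)))"

lemma flow_on_skew: "flow_on E f \<Longrightarrow> f j i = - f i j"
  by (simp add: flow_on_def eq_neg_iff_add_eq_0)

lemma flow_on_support: "flow_on E f \<Longrightarrow> f i j \<noteq> 0 \<Longrightarrow> E i j"
  by (simp add: flow_on_def)

lemma flow_on_lincomb:
  assumes "flow_on E f" "flow_on E g"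
  shows "flow_on E (\<lambda>i j. a * f i j + b * g i j)"
  unfolding flow_on_def
proof (intro conjI allI impI)
  fix i j
  have "(a * f i j + b * g i j) + (a * f j i + b * g j i) = a * (f i j + f j i) + b * (g i j + g j i)"
    by (simp add: algebra_simps)
  then show "(a * f i j + b * g i j) + (a * f j i + b * g j i) = 0"
    using assms by (simp add: flow_on_def)
  assume "a * f i j + b * g i j \<noteq> 0"
  then have "f i j \<noteq> 0 \<or> g i j \<noteq> 0" by auto
  then show "E i j" using assms by (auto simp: flow_on_def)
qed

lemma outflow_lincomb:
  "outflow (\<lambda>i j. a * f i j + b * g i j) i = a * outflow f i + b * outflow g i"
  by (simp add: outflow_def sum.distrib sum_distrib_left)

lemma flow_on_mono:
  assumes "flow_on E f" "\<And>i j. E i j \<Longrightarrow> E' i j"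
  shows "flow_on E' f"
  using assms by (auto simp: flow_on_def)

lemma flow_on_edge_flow:
  assumes "E u v" "symp E"
  shows "flow_on E (edge_flow u v)"
  unfolding flow_on_def
proof (intro conjI allI impI)
  show "edge_flow u v i j + edge_flow u v j i = 0" for i j
    by (simp add: edge_flow_def conj_commute)
  show "E i j" if "edge_flow u v i j \<noteq> 0" for i j
  proof -
    have "i = u \<and> j = v \<or> i = v \<and> j = u"
      using that by (auto simp: edge_flow_def split: if_splits)
    then show ?thesis using assms by (auto dest: sympD)
  qed
qed

lemma outflow_edge_flow: "outflow (edge_flow u v) i = of_bool (i = u) - of_bool (i = v)"
proof -
  have "outflow (edge_flow u v) i =
      (\<Sum>j\<in>UNIV. (if j = v then of_bool (i = u) else 0)) -
      (\<Sum>j\<in>UNIV. (if j = u then of_bool (i = v) else 0))"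
    unfolding outflow_def edge_flow_def sum_subtractf
    by (intro arg_cong2[of _ _ _ _ "(-)"] sum.cong) auto
  then show ?thesis by simp
qed

lemma linked_refl: "linked E u u"
  unfolding linked_def flow_on_def outflow_def by (rule exI[of _ "\<lambda>_ _. 0"]) simp

lemma linked_edge: "E u v \<Longrightarrow> symp E \<Longrightarrow> linked E u v"
  unfolding linked_def
  by (intro exI[of _ "edge_flow u v"]) (simp add: flow_on_edge_flow outflow_edge_flow)

lemma linked_sym:
  assumes "linked E u v"
  shows "linked E v u"
proof -
  obtain f where "flow_on E f" "\<forall>i. outflow f i = of_bool (i = u) - of_bool (i = v)"
    using assms by (auto simp: linked_def)
  then show ?thesis unfolding linked_def
    using flow_on_lincomb[of E f f "-1" 0] outflow_lincomb[of "-1" f 0 f]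
    by (intro exI[of _ "\<lambda>i j. -1 * f i j + 0 * f i j"]) auto
qed

lemma linked_trans:
  assumes "linked E u v" "linked E v w"
  shows "linked E u w"
proof -
  obtain f g where "flow_on E f" "\<forall>i. outflow f i = of_bool (i = u) - of_bool (i = v)"
    "flow_on E g" "\<forall>i. outflow g i = of_bool (i = v) - of_bool (i = w)"
    using assms by (auto simp: linked_def)
  then show ?thesis unfolding linked_def
    using flow_on_lincomb[of E f g 1 1] outflow_lincomb[of 1 f 1 g]
    by (intro exI[of _ "\<lambda>i j. 1 * f i j + 1 * g i j"]) auto
qed

text \<open>
  The net flow within \<open>U\<close> cancels by skew symmetry. If no edge leaves \<open>U\<close>, the total outflow of
  \<open>U\<close> is hence zero, and a source in \<open>U\<close> forces the sink to be in \<open>U\<close>.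
\<close>

lemma linked_closed:
  assumes "linked E u v" "u \<in> U" "\<And>i j. i \<in> U \<Longrightarrow> E i j \<Longrightarrow> j \<in> U"
  shows "v \<in> U"
proof -
  obtain f where f: "flow_on E f" and out: "\<forall>i. outflow f i = of_bool (i = u) - of_bool (i = v)"
    using assms by (auto simp: linked_def)
  \<comment> \<open>Swapping the summation indices shows \<open>S = - S\<close>.\<close>
  define S where "S = (\<Sum>i\<in>U. \<Sum>j\<in>U. f i j)"
  have skew: "f j i = - f i j" for i j using f by (rule flow_on_skew)
  have "S = (\<Sum>j\<in>U. \<Sum>i\<in>U. f i j)" unfolding S_def by (rule sum.swap)
  also have "\<dots> = (\<Sum>j\<in>U. \<Sum>i\<in>U. - f j i)"
    by (intro sum.cong refl) (rule skew)
  also have "\<dots> = - S" by (simp add: S_def sum_negf)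
  finally have "S = 0" by simp
  have "outflow f i = (\<Sum>j\<in>U. f i j)" if "i \<in> U" for i
    unfolding outflow_def
    using that flow_on_support[OF f] assms(3) by (intro sum.mono_neutral_right) auto
  then have "S = (\<Sum>i\<in>U. outflow f i)" by (simp add: S_def)
  also have "\<dots> = of_bool (u \<in> U) - of_bool (v \<in> U)"
    by (simp add: out sum_subtractf of_bool_def)
  finally show ?thesis using \<open>S = 0\<close> \<open>u \<in> U\<close> by (auto split: if_splits)
qed

lemma circulation_lincomb:
  assumes "circulation E f" "circulation E g"
  shows "circulation E (\<lambda>i j. a * f i j + b * g i j)"
  using assms flow_on_lincomb[of E f g a b] by (simp add: circulation_def outflow_lincomb)

lemma close_up_flow:
  assumes "flow_on E f" "\<And>i. outflow f i = of_bool (i = u) - of_bool (i = v)" "E u v" "symp E"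
  shows "circulation E (\<lambda>i j. f i j - edge_flow u v i j)"
  using assms flow_on_lincomb[OF assms(1) flow_on_edge_flow[OF assms(3,4)], of 1 "-1"]
    outflow_lincomb[of 1 f "-1" "edge_flow u v"] outflow_edge_flow[of u v]
  by (simp add: circulation_def)

text \<open>
  A unit flow avoiding the edge \<open>uv\<close>, closed up by that edge, is a circulation through it.
\<close>

lemma chord_circulation:
  assumes "linked E u v" "\<And>i j. E i j \<Longrightarrow> G i j" "G u v" "\<not> E u v" "symp G" "irreflp G"
  obtains s where "circulation G s" "s u v \<noteq> 0"
proof -
  obtain f where f: "flow_on E f" and out: "\<And>i. outflow f i = of_bool (i = u) - of_bool (i = v)"
    using assms by (auto simp: linked_def)
  have "circulation G (\<lambda>i j. f i j - edge_flow u v i j)"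
    by (rule close_up_flow[OF flow_on_mono[OF f assms(2)] out assms(3,5)])
  moreover have "f u v - edge_flow u v u v \<noteq> 0"
  proof -
    have "f u v = 0" using flow_on_support[OF f] assms(4) by blast
    moreover have "u \<noteq> v" using assms(3,6) by (auto simp: irreflp_def)
    ultimately show ?thesis by (simp add: edge_flow_def)
  qed
  ultimately show ?thesis by (rule that)
qed

text \<open>
  A finite-dimensional real vector space is not a finite union of the proper subspaces on which one
  edge vanishes. The proof adds one edge at a time: a multiple \<open>e\<close> of a circulation through the new
  edge is added, and only finitely many \<open>e\<close> cancel the value on some edge.
\<close>

lemma generic_circulation:
  fixes E :: "'v::finite graph"
  shows "\<exists>s. circulation E s \<and> (\<forall>i j. (\<exists>s'. circulation E s' \<and> s' i j \<noteq> 0) \<longrightarrow> s i j \<noteq> 0)"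
proof -
  define live where "live = {(i, j). \<exists>s'. circulation E s' \<and> s' i j \<noteq> 0}"
  have "finite F \<Longrightarrow> F \<subseteq> live \<Longrightarrow> \<exists>s. circulation E s \<and> (\<forall>(i, j)\<in>F. s i j \<noteq> 0)" for F
  proof (induction F rule: finite_induct)
    case empty
    have "circulation E (\<lambda>_ _. 0)" by (simp add: circulation_def flow_on_def outflow_def)
    then show ?case by blast
  next
    case (insert p F)
    obtain a b where p: "p = (a, b)" by fastforce
    obtain s where s: "circulation E s" "\<forall>(i, j)\<in>F. s i j \<noteq> 0" using insert by auto
    obtain s' where s': "circulation E s'" "s' a b \<noteq> 0"
      using insert.prems by (auto simp: p live_def)
    define bad where "bad = (\<lambda>(i, j). - s i j / s' i j) ` insert p F"
    obtain e where e: "e \<notin> bad"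
      using ex_new_if_finite[OF infinite_UNIV_char_0, of bad] insert.hyps by (auto simp: bad_def)
    have "s i j + e * s' i j \<noteq> 0" if "(i, j) \<in> insert p F" for i j
    proof (cases "s' i j = 0")
      case True
      then show ?thesis using that s s' by (auto simp: p)
    next
      case False
      have "e \<noteq> - s i j / s' i j" using that e by (force simp: bad_def)
      then show ?thesis using False by (auto simp: field_simps add_eq_0_iff)
    qed
    then show ?case
      using circulation_lincomb[OF s(1) s'(1), of 1 e]
      by (intro exI[of _ "\<lambda>i j. 1 * s i j + e * s' i j"]) auto
  qed
  from this[of live] obtain s where "circulation E s" "\<forall>(i, j)\<in>live. s i j \<noteq> 0"
    by auto
  then show ?thesis by (auto simp: live_def)
qed

text \<open>
  In a simple graph these are the bridges, the edges on no cycle.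
\<close>

definition rigid_edges :: "'v::finite graph \<Rightarrow> 'v graph" where
  "rigid_edges G i j \<longleftrightarrow> G i j \<and> (\<forall>s. circulation G s \<longrightarrow> s i j = 0)"

lemma rigid_edges_symp: "symp G \<Longrightarrow> symp (rigid_edges G)"
  unfolding rigid_edges_def symp_def circulation_def
  by (metis flow_on_skew neg_equal_0_iff_equal)

text \<open>
  A unit flow \<open>f\<close> along rigid edges from \<open>u\<close> to \<open>v\<close>, closed up by the edge \<open>uv\<close>, is a
  circulation of \<open>G\<close> that agrees with \<open>f\<close> on rigid edges. It must vanish there, so \<open>f = 0\<close>,
  which contradicts the unit outflow at \<open>u\<close>.
\<close>

lemma not_linked_rigid_edges:
  assumes G: "symp G" "irreflp G" and s: "circulation G s" "s u v \<noteq> 0"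
  shows "\<not> linked (rigid_edges G) u v"
proof
  assume "linked (rigid_edges G) u v"
  then obtain f where f: "flow_on (rigid_edges G) f"
    and out: "\<And>i. outflow f i = of_bool (i = u) - of_bool (i = v)"
    by (auto simp: linked_def)
  have uv: "G u v" using s flow_on_support[of G s u v] by (simp add: circulation_def)
  have nr: "\<not> rigid_edges G u v" "\<not> rigid_edges G v u"
    using s rigid_edges_symp[OF G(1)] unfolding rigid_edges_def symp_def by blast+
  have c: "circulation G (\<lambda>i j. f i j - edge_flow u v i j)"
    by (rule close_up_flow[OF flow_on_mono[OF f] out uv G(1)]) (simp add: rigid_edges_def)
  have "f i j = 0" for i j
  proof (rule ccontr)
    assume "f i j \<noteq> 0"
    then have r: "rigid_edges G i j" by (rule flow_on_support[OF f])
    then have "f i j - edge_flow u v i j = 0" using c unfolding rigid_edges_def by blast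
    moreover have "edge_flow u v i j = 0" using r nr by (auto simp: edge_flow_def)
    ultimately show False using \<open>f i j \<noteq> 0\<close> by simp
  qed
  then have "outflow f u = 0" by (simp add: outflow_def)
  moreover have "u \<noteq> v" using uv G by (auto simp: irreflp_def)
  ultimately show False using out[of u] by simp
qed

section \<open>Matrices of corank two\<close>

text \<open>
  The electrical construction: the potential \<open>t\<close> separates the classes of vertices linked by rigid
  edges, and the conductances \<open>w\<close> make the generic circulation \<open>s\<close> the current driven by \<open>t\<close>.
  The kernel contains the constants and \<open>t\<close>, which differ because there are at least two classes.
\<close>

lemma low_rank_if_not_all_linked_rigidly:
  fixes G :: "'v::finite graph"
  assumes G: "simple_graph G" and "\<not> linked (rigid_edges G) p q"
  shows "\<exists>A\<in>sym_matrices G. rank A + 2 \<le> CARD('v)"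
proof -
  have sG: "symp G" "irreflp G" using G by (auto simp: simple_graph_def)
  obtain s where s: "circulation G s"
    and gen: "\<And>i j. (\<exists>s'. circulation G s' \<and> s' i j \<noteq> 0) \<Longrightarrow> s i j \<noteq> 0"
    using generic_circulation[of G] by blast
  have fs: "flow_on G s" using s by (simp add: circulation_def)
  obtain enum :: "'v set \<Rightarrow> nat" where enum: "inj enum"
    using finite_imp_inj_to_nat_seg[of "UNIV :: 'v set set"] by auto
  \<comment> \<open>Any injective numbering of the classes serves as a potential.\<close>
  define t where "t i = real (enum {j. linked (rigid_edges G) i j})" for i
  have t_eq: "t i = t j \<longleftrightarrow> linked (rigid_edges G) i j" for i j
  proof -
    have "t i = t j \<longleftrightarrow> {k. linked (rigid_edges G) i k} = {k. linked (rigid_edges G) j k}"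
      unfolding t_def using enum by (auto dest: injD)
    also have "\<dots> \<longleftrightarrow> linked (rigid_edges G) i j"
    proof
      assume "{k. linked (rigid_edges G) i k} = {k. linked (rigid_edges G) j k}"
      then show "linked (rigid_edges G) i j" using linked_refl[of "rigid_edges G" j] by blast
    next
      assume "linked (rigid_edges G) i j"
      then show "{k. linked (rigid_edges G) i k} = {k. linked (rigid_edges G) j k}"
        using linked_sym linked_trans by blast
    qed
    finally show ?thesis .
  qed
  have flow_iff: "t i \<noteq> t j \<longleftrightarrow> s i j \<noteq> 0" if "G i j" for i j
  proof
    assume "t i \<noteq> t j"
    then have "\<not> rigid_edges G i j"
      using t_eq linked_edge[OF _ rigid_edges_symp[OF sG(1)]] by blast
    then show "s i j \<noteq> 0" using gen that by (auto simp: rigid_edges_def)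
  next
    assume "s i j \<noteq> 0"
    then show "t i \<noteq> t j" using not_linked_rigid_edges sG s t_eq by blast
  qed
  \<comment> \<open>Edges within a class carry no current, so their conductance may be any nonzero number.\<close>
  define w where "w i j = (if G i j then if t i = t j then 1 else s i j / (t j - t i) else 0)" for i j
  have "w i j = w j i" for i j
    using sG(1) flow_on_skew[OF fs, of j i] minus_divide_right[of "s i j" "t j - t i"]
    by (auto simp: w_def symp_def)
  moreover have "w i j \<noteq> 0 \<longleftrightarrow> G i j" for i j
    using flow_iff[of i j] by (cases "t i = t j") (auto simp: w_def)
  ultimately have mem: "schroedinger_matrix w (\<lambda>_. 0) \<in> sym_matrices G"
    by (intro schroedinger_matrix_in_sym_matrices)
  have current: "w i j * (t j - t i) = s i j" for i j
    using flow_iff[of i j] flow_on_support[OF fs, of i j]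
    by (cases "t i = t j") (auto simp: w_def)
  have "schroedinger_matrix w (\<lambda>_. 0) *v (\<chi> i. 1) = 0"
    by (simp add: vec_eq_iff schroedinger_matrix_mult)
  moreover have "schroedinger_matrix w (\<lambda>_. 0) *v (\<chi> i. t i) = 0"
    using s by (simp add: vec_eq_iff schroedinger_matrix_mult current circulation_def outflow_def)
  moreover have "t q \<noteq> t p" using assms(2) t_eq[of p q] by metis
  ultimately have "rank (schroedinger_matrix w (\<lambda>_. 0)) + 2 \<le> CARD('v)"
    by (intro rank_le_if_two_kernel_vectors[where x = "\<chi> i. 1" and y = "\<chi> i. t i" and i = p and j = q]) simp_all
  with mem show ?thesis by blast
qed

text \<open>
  Deleting \<open>c\<close> splits the tree into one branch for each neighbour of \<open>c\<close>. The matrix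
  is the Laplacian plus a unit potential at the neighbours of \<open>c\<close>, which compensates their edge to
  \<open>c\<close>. A function that is constant on branches and zero at \<open>c\<close> is therefore annihilated in every
  row but that of \<open>c\<close>, where the result is the sum of its values on the branches. That sum
  vanishes for the difference of the indicators of two branches.
\<close>

lemma low_rank_if_branching_tree:
  fixes G :: "'v::finite graph"
  assumes G: "simple_graph G"
    and tree: "\<And>i j. linked G i j" "\<And>s i j. circulation G s \<Longrightarrow> s i j = 0"
    and nbrs: "G c x" "G c y" "G c z" "x \<noteq> y" "x \<noteq> z" "y \<noteq> z"
  shows "\<exists>A\<in>sym_matrices G. rank A + 2 \<le> CARD('v)"
proof -
  have sG: "symp G" "irreflp G" using G by (auto simp: simple_graph_def)
  obtain F where F: "\<And>j. flow_on G (F j)"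
    and out: "\<And>j i. outflow (F j) i = of_bool (i = j) - of_bool (i = c)"
    using tree(1)[of _ c] unfolding linked_def by metis
  \<comment> \<open>With \<open>F j\<close> the unit flow from \<open>j\<close> to \<open>c\<close>, the function \<open>b m\<close> is the indicator of the
    branch at the neighbour \<open>m\<close>: the flow from that branch reaches \<open>c\<close> through \<open>m\<close>.\<close>
  define b where "b m j = F j m c" for m j
  \<comment> \<open>Without circulations, moving the source along an edge changes the flow on that edge only.\<close>
  have diff: "F j u v - F k u v = edge_flow j k u v" if "G j k" for j k u v
  proof -
    have "outflow (\<lambda>u v. 1 * F j u v + -1 * F k u v) i = of_bool (i = j) - of_bool (i = k)" for i
      unfolding outflow_lincomb out by simp
    then have "circulation G (\<lambda>u v. (1 * F j u v + -1 * F k u v) - edge_flow j k u v)"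
      using that sG by (intro close_up_flow flow_on_lincomb F)
    from tree(2)[OF this, of u v] show ?thesis by simp
  qed
  have b_c: "b m c = 0" for m
  proof -
    have "circulation G (F c)" using F[of c] out[of c] by (simp add: circulation_def)
    then show ?thesis using tree(2) by (auto simp: b_def)
  qed
  have b_const: "b m j = b m k" if "G j k" "j \<noteq> c" "k \<noteq> c" for m j k
    using diff[of j k m c] that by (simp add: b_def edge_flow_def)
  have b_nbr: "b m k = of_bool (m = k)" if "G c k" "m \<noteq> c" for m k
    using diff[of c k m c] that b_c[of m] by (simp add: b_def edge_flow_def of_bool_def split: if_splits)
  have ne: "x \<noteq> c" "y \<noteq> c" "z \<noteq> c" using nbrs sG by (auto simp: irreflp_def)
  define A where "A = schroedinger_matrix (\<lambda>i j. of_bool (G i j)) (\<lambda>i. of_bool (G i c))"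
  have mem: "A \<in> sym_matrices G"
    unfolding A_def using sG
    by (intro schroedinger_matrix_in_sym_matrices) (auto simp: of_bool_def symp_def)
  have kernel: "A *v (\<chi> i. b m i - b m' i) = 0" if m: "G c m" "m \<noteq> c" "G c m'" "m' \<noteq> c" for m m'
  proof -
    define h where "h i = b m i - b m' i" for i
    have hc: "h c = 0" by (simp add: h_def b_c)
    have "(A *v (\<chi> i. h i)) $ i = 0" for i
    proof (cases "i = c")
      case True
      have "of_bool (G c j) * h j = of_bool (j = m) - of_bool (j = m')" for j
        using b_nbr m by (auto simp: h_def)
      then show ?thesis using sG
        by (simp add: True A_def schroedinger_matrix_mult hc sum_subtractf irreflp_def of_bool_def)
    next
      case False
      have "of_bool (G i j) * (h j - h i) = (if j = c then - of_bool (G i c) * h i else 0)" for j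
        using b_const[of i j] False by (auto simp: h_def b_c)
      then show ?thesis by (simp add: A_def schroedinger_matrix_mult)
    qed
    then show ?thesis by (simp add: vec_eq_iff h_def)
  qed
  have "rank A + 2 \<le> CARD('v)"
    using nbrs ne
    by (intro rank_le_if_two_kernel_vectors[OF kernel[of x y] kernel[of x z], where i = y and j = z])
      (auto simp: b_nbr)
  with mem show ?thesis by blast
qed

section \<open>Trees without branching are paths\<close>

text \<open>
  Take a longest path \<open>p\<close>. A vertex adjacent to an end would lengthen it, and one adjacent to an
  inner vertex would be a third neighbour, so by connectedness \<open>p\<close> visits all vertices. An edge
  joining vertices that are not consecutive on \<open>p\<close> would close a cycle.
\<close>

lemma path_if_unbranched_tree:
  fixes G :: "'v::finite graph"
  assumes G: "simple_graph G"
    and tree: "\<And>i j. linked G i j" "\<And>s i j. circulation G s \<Longrightarrow> s i j = 0"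
    and deg: "\<And>c x y z. G c x \<Longrightarrow> G c y \<Longrightarrow> G c z \<Longrightarrow> x = y \<or> x = z \<or> y = z"
  shows "is_path_graph G"
proof -
  have sG: "symp G" "irreflp G" using G by (auto simp: simple_graph_def)
  have sym: "G i j \<Longrightarrow> G j i" for i j using sG by (auto simp: symp_def)
  define walk where "walk m p \<longleftrightarrow> inj_on p {..<m} \<and> (\<forall>i. Suc i < m \<longrightarrow> G (p i) (p (Suc i)))"
    for m and p :: "nat \<Rightarrow> 'v"
  have bound: "m \<le> CARD('v)" if "walk m p" for m p
    using card_mono[of UNIV "p ` {..<m}"] that by (auto simp: walk_def card_image)
  have walk1: "walk 1 p" for p by (auto simp: walk_def inj_on_def)
  define m where "m = (GREATEST m. \<exists>p. walk m p)"
  have "\<exists>p. walk m p"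
    unfolding m_def
  proof (rule GreatestI_nat)
    show "\<exists>p. walk 1 p" using walk1 by blast
    show "\<exists>p. walk k p \<Longrightarrow> k \<le> CARD('v)" for k using bound by blast
  qed
  then obtain p where p: "walk m p" by blast
  have max: "k \<le> m" if "walk k q" for k q
    unfolding m_def
  proof (rule Greatest_le_nat)
    show "\<exists>p. walk k p" using that by blast
    show "\<exists>p. walk l p \<Longrightarrow> l \<le> CARD('v)" for l using bound by blast
  qed
  have m: "1 \<le> m" using max[OF walk1] .
  have inj: "inj_on p {..<m}" and step: "\<And>i. Suc i < m \<Longrightarrow> G (p i) (p (Suc i))"
    using p by (auto simp: walk_def)
  have closed: "w \<in> p ` {..<m}" if u: "u \<in> p ` {..<m}" and uw: "G u w" for u w
  proof (rule ccontr)
    assume w: "w \<notin> p ` {..<m}"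
    obtain i where i: "i < m" "u = p i" using u by auto
    consider "i = 0" | "Suc i = m" | "0 < i" "Suc i < m" using i by linarith
    then show False
    proof cases
      case 1
      define q where "q = case_nat w p"
      have "walk (Suc m) q"
        unfolding walk_def
      proof (intro conjI allI impI)
        have "{..<Suc m} = insert 0 (Suc ` {..<m})" by (simp add: lessThan_Suc_eq_insert_0)
        then show "inj_on q {..<Suc m}"
          using inj w by (auto simp: q_def inj_on_def)
        fix k assume "Suc k < Suc m"
        then show "G (q k) (q (Suc k))"
          using step uw 1 i sym by (cases k) (auto simp: q_def)
      qed
      then show False using max[of "Suc m" q] by simp
    next
      case 2
      define q where "q = p(m := w)"
      have "walk (Suc m) q"
        unfolding walk_def
      proof (intro conjI allI impI)
        show "inj_on q {..<Suc m}"
          using inj w by (auto simp: q_def inj_on_def less_Suc_eq)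
        fix k assume "Suc k < Suc m"
        then show "G (q k) (q (Suc k))"
          using step uw 2 i by (cases "k = i") (auto simp: q_def)
      qed
      then show False using max[of "Suc m" q] by simp
    next
      case 3
      then obtain k where k: "i = Suc k" by (cases i) auto
      have "G u (p k)" "G u (p (Suc i))"
        using step[of k] step[of i] 3 k i sym by auto
      moreover have "p k \<noteq> p (Suc i)" using inj_on_eq_iff[OF inj, of k "Suc i"] 3 k by simp
      ultimately show False using deg[of u "p k" "p (Suc i)" w] uw w 3 k by auto
    qed
  qed
  have "v \<in> p ` {..<m}" for v
    using linked_closed[OF tree(1)[of "p 0" v], of "p ` {..<m}"] closed m by auto
  then have surj: "p ` {..<m} = UNIV" by auto
  then have bij: "bij_betw p {..<m} UNIV" using inj by (simp add: bij_betw_def)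
  then have card: "m = CARD('v)" using bij_betw_same_card by fastforce
  have forward: "j = Suc i" if ij: "i < j" "j < m" "G (p i) (p j)" for i j
  proof (rule ccontr)
    assume no: "j \<noteq> Suc i"
    \<comment> \<open>Only the edges of \<open>p\<close> itself, among which the supposed chord does not occur.\<close>
    define E where "E a b \<longleftrightarrow> (\<exists>l. Suc l < m \<and> {a, b} = {p l, p (Suc l)})" for a b
    have E: "symp E" by (auto simp: E_def symp_def insert_commute)
    have EG: "E a b \<Longrightarrow> G a b" for a b
      using step sym by (auto simp: E_def doubleton_eq_iff)
    have "linked E (p i) (p k)" if "i \<le> k" "k < m" for k
      using that
    proof (induction k rule: dec_induct)
      case base
      show ?case by (rule linked_refl)
    next
      case (step k)
      have "E (p k) (p (Suc k))" using step by (auto simp: E_def)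
      then show ?case using step linked_edge[OF _ E] linked_trans by (metis Suc_lessD)
    qed
    then have "linked E (p i) (p j)" using ij by simp
    moreover have "\<not> E (p i) (p j)"
      using ij no inj_on_eq_iff[OF inj] by (auto simp: E_def doubleton_eq_iff)
    ultimately show False using chord_circulation[OF _ EG ij(3) _ sG] tree(2) by metis
  qed
  have "G (p i) (p j) \<longleftrightarrow> path_graph i j" if "i < m" "j < m" for i j
  proof
    assume g: "G (p i) (p j)"
    then have "i \<noteq> j" using sG by (auto simp: irreflp_def)
    then consider "i < j" | "j < i" by linarith
    then show "path_graph i j"
      using forward[of i j] forward[of j i] g sym that by cases (auto simp: path_graph_def)
  next
    assume "path_graph i j"
    then show "G (p i) (p j)"
      using step sym that by (auto simp: path_graph_def)
  qed
  then show ?thesis unfolding is_path_graph_def using bij card by auto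
qed

lemma path_graph_if_no_low_rank:
  fixes G :: "'v::finite graph"
  assumes G: "simple_graph G" and full: "\<And>A. A \<in> sym_matrices G \<Longrightarrow> CARD('v) \<le> rank A + 1"
  shows "is_path_graph G"
proof -
  have no: "\<not> (\<exists>A\<in>sym_matrices G. rank A + 2 \<le> CARD('v))" using full by fastforce
  have rigid: "linked (rigid_edges G) i j" for i j
    using low_rank_if_not_all_linked_rigidly[OF G] no by blast
  have acyclic: "s i j = 0" if "circulation G s" for s i j
    using not_linked_rigid_edges rigid that G unfolding simple_graph_def by blast
  have conn: "linked G i j" for i j
    using rigid[of i j] flow_on_mono[of "rigid_edges G" _ G]
    unfolding linked_def rigid_edges_def by blast
  show ?thesis
  proof (rule path_if_unbranched_tree)
    show "simple_graph G" "linked G i j" for i j by (fact G conn)+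
    show "s i j = 0" if "circulation G s" for s i j using that by (rule acyclic)
    fix c x y z assume "G c x" "G c y" "G c z"
    then show "x = y \<or> x = z \<or> y = z"
      using low_rank_if_branching_tree[where G = G, OF G conn] acyclic no by blast
  qed
qed

section \<open>Minimum rank of a path\<close>

text \<open>
  The row of the vertex \<open>f l\<close> expresses the entry of a kernel vector at \<open>f (Suc l)\<close> by the
  entries before it, so the entry at the end \<open>f 0\<close> determines the vector.
\<close>

lemma rank_ge_if_path:
  fixes G :: "'v::finite graph"
  assumes "is_path_graph G" and A: "A \<in> sym_matrices G"
  shows "CARD('v) \<le> rank A + 1"
proof -
  obtain f where bij: "bij_betw f {..<CARD('v)} (UNIV :: 'v set)"
    and G: "\<And>i j. i < CARD('v) \<Longrightarrow> j < CARD('v) \<Longrightarrow> G (f i) (f j) \<longleftrightarrow> path_graph i j"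
    using assms(1) unfolding is_path_graph_def by blast
  show ?thesis
  proof (rule rank_ge_if_kernel_detected[where i = "f 0"])
    fix x assume Ax: "A *v x = 0" and x0: "x $ f 0 = 0"
    have "x $ f k = 0" if "k < CARD('v)" for k
      using that
    proof (induction k rule: less_induct)
      case (less k)
      show ?case
      proof (cases k)
        case 0
        then show ?thesis using x0 by simp
      next
        case (Suc l)
        have inj: "f i = f j \<longleftrightarrow> i = j" if "i < CARD('v)" "j < CARD('v)" for i j
          using bij that by (auto simp: bij_betw_def inj_on_def)
        have zero: "A $ f l $ v * x $ v = 0" if "v \<noteq> f k" for v
        proof -
          obtain j where j: "j < CARD('v)" "v = f j"
            using bij by (metis UNIV_I bij_betw_def imageE lessThan_iff)
          show ?thesis
          proof (cases "j < k")
            case True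
            then show ?thesis using less j by simp
          next
            case False
            then have "\<not> path_graph l j" "l \<noteq> j" using that j Suc by (auto simp: path_graph_def)
            then have "\<not> G (f l) v" "f l \<noteq> v" using G j less.prems Suc inj by auto
            then show ?thesis using A by (auto simp: sym_matrices_def)
          qed
        qed
        have rest: "(\<Sum>v\<in>UNIV - {f k}. A $ f l $ v * x $ v) = 0"
          by (rule sum.neutral) (use zero in blast)
        have "0 = (A *v x) $ f l" using Ax by simp
        also have "\<dots> = (\<Sum>v\<in>UNIV. A $ f l $ v * x $ v)" by (simp add: matrix_vector_mult_def)
        also have "\<dots> = A $ f l $ f k * x $ f k"
          by (simp add: sum.remove[of UNIV "f k"] rest)
        finally have "A $ f l $ f k * x $ f k = 0" by simp
        moreover have "A $ f l $ f k \<noteq> 0"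
          using A G[of l k] inj[of l k] less.prems Suc by (auto simp: sym_matrices_def path_graph_def)
        ultimately show ?thesis by simp
      qed
    qed
    then show "x = 0"
      using bij by (auto simp: vec_eq_iff bij_betw_def) (metis UNIV_I imageE lessThan_iff)
  qed
qed

text \<open>
  The Laplacian annihilates the constant vectors.
\<close>

lemma singular_sym_matrix:
  fixes G :: "'v::finite graph"
  assumes "simple_graph G"
  shows "\<exists>A\<in>sym_matrices G. rank A \<le> CARD('v) - 1"
proof -
  define A where "A = schroedinger_matrix (\<lambda>i j. of_bool (G i j)) (\<lambda>_. 0)"
  have "A \<in> sym_matrices G"
    unfolding A_def using assms
    by (intro schroedinger_matrix_in_sym_matrices) (auto simp: simple_graph_def symp_def of_bool_def)
  moreover have "A *v (\<chi> i. 1) = 0"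
    by (simp add: A_def vec_eq_iff schroedinger_matrix_mult)
  moreover have "(\<chi> i. 1) \<noteq> (0 :: real^'v)" by (simp add: vec_eq_iff)
  ultimately show ?thesis
    using matrix_nonfull_linear_equations_eq[of A] rank_bound[of A]
    by (intro bexI[of _ A]) force+
qed

lemma card_adjacent_pairs_path:
  fixes G :: "'v::finite graph"
  assumes "is_path_graph G"
  shows "card {(u, v). G u v} = card {(i, j). i < CARD('v) \<and> j < CARD('v) \<and> path_graph i j}"
proof -
  obtain f where bij: "bij_betw f {..<CARD('v)} (UNIV :: 'v set)"
    and G: "\<And>i j. i < CARD('v) \<Longrightarrow> j < CARD('v) \<Longrightarrow> G (f i) (f j) \<longleftrightarrow> path_graph i j"
    using assms unfolding is_path_graph_def by blast
  have "bij_betw (map_prod f f) {(i, j). i < CARD('v) \<and> j < CARD('v) \<and> path_graph i j} {(u, v). G u v}"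
    unfolding bij_betw_def
  proof (intro conjI set_eqI iffI)
    show "inj_on (map_prod f f) {(i, j). i < CARD('v) \<and> j < CARD('v) \<and> path_graph i j}"
      using bij by (auto simp: bij_betw_def inj_on_def)
  next
    fix e assume "e \<in> {(u, v). G u v}"
    then obtain u v where e: "e = (u, v)" "G u v" by blast
    have range: "\<exists>i<CARD('v). x = f i" for x
      using bij unfolding bij_betw_def by (metis UNIV_I imageE lessThan_iff)
    obtain i j where "i < CARD('v)" "j < CARD('v)" "u = f i" "v = f j"
      using range[of u] range[of v] by blast
    then show "e \<in> map_prod f f ` {(i, j). i < CARD('v) \<and> j < CARD('v) \<and> path_graph i j}"
      using e G by (intro image_eqI[of _ _ "(i, j)"]) auto
  next
    fix e assume "e \<in> map_prod f f ` {(i, j). i < CARD('v) \<and> j < CARD('v) \<and> path_graph i j}"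
    then show "e \<in> {(u, v). G u v}" by (auto simp: G)
  qed
  then show ?thesis by (rule bij_betw_same_card[symmetric])
qed

text \<open>
  Both graphs have the same number of edges, as the numbering of the vertices carries these
  to the pairs of consecutive numbers.
\<close>

lemma path_graph_maximal:
  fixes G :: "'v::finite graph"
  assumes "is_path_graph G" "is_path_graph H" "\<And>u v. G u v \<Longrightarrow> H u v"
  shows "G = H"
proof -
  have "{(u, v). G u v} = {(u, v). H u v}"
    using assms card_adjacent_pairs_path[of G] card_adjacent_pairs_path[of H]
    by (intro card_subset_eq) auto
  then show ?thesis by (auto simp: fun_eq_iff)
qed

theorem proposition5p5:
  fixes G :: "'v::finite graph" and N :: "'v set"
  assumes "probe_graph G N"
  shows "mr G N = CARD('v) - 1 \<longleftrightarrow> card N \<le> 1 \<and> is_path_graph G"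
proof
  assume mr: "mr G N = CARD('v) - 1"
  have paths: "is_path_graph H" if H: "H \<in> probe_completions G N" for H
  proof (rule path_graph_if_no_low_rank)
    show "simple_graph H" using H by (simp add: probe_completions_def)
    fix A assume "A \<in> sym_matrices H"
    then have "A \<in> probe_matrices G N" using H by (auto simp: probe_matrices_def)
    from mr_le[OF this] show "CARD('v) \<le> rank A + 1" using mr by linarith
  qed
  have G: "is_path_graph G" using paths self_in_probe_completions[OF assms] by blast
  have "card N \<le> 1"
  proof (rule ccontr)
    assume "\<not> card N \<le> 1"
    then obtain u v where uv: "u \<in> N" "v \<in> N" "u \<noteq> v"
      by (metis One_nat_def card_le_Suc0_iff_eq finite)
    define H where "H a b \<longleftrightarrow> G a b \<or> a = u \<and> b = v \<or> a = v \<and> b = u" for a b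
    have "H \<in> probe_completions G N"
      using assms uv
      by (auto simp: H_def probe_completions_def probe_graph_def simple_graph_def symp_def irreflp_def)
    then have "G = H" using path_graph_maximal[OF G paths] by (auto simp: H_def)
    moreover have "\<not> G u v" using assms uv by (auto simp: probe_graph_def independent_in_def)
    ultimately show False by (metis H_def)
  qed
  then show "card N \<le> 1 \<and> is_path_graph G" using G by blast
next
  assume N: "card N \<le> 1 \<and> is_path_graph G"
  have G: "simple_graph G" using assms by (simp add: probe_graph_def)
  have "H = G" if H: "H \<in> probe_completions G N" for H
  proof -
    have eq: "u = v" if "u \<in> N" "v \<in> N" for u v
      using N that by (metis One_nat_def card_le_Suc0_iff_eq finite)
    have "H u v \<longleftrightarrow> G u v" for u v
      using H eq by (auto simp: probe_completions_def simple_graph_def irreflp_def) metis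
    then show ?thesis by (simp add: fun_eq_iff)
  qed
  then have eq: "probe_matrices G N = sym_matrices G"
    using self_in_probe_completions[OF assms] by (auto simp: probe_matrices_def)
  obtain A where "A \<in> sym_matrices G" "rank A \<le> CARD('v) - 1"
    using singular_sym_matrix[OF G] by blast
  then have "mr G N \<le> CARD('v) - 1" using mr_le[of A G N] eq by simp
  moreover have "CARD('v) \<le> mr G N + 1"
    using mr_attained[OF assms] rank_ge_if_path N eq by metis
  ultimately show "mr G N = CARD('v) - 1" by linarith
qed

end
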